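(* Let $n\ge 2$, $1\le k<n$, and let $P\subset[0,1]^n$ be a set of $N$ points with mutual separation $$|p-p'|\gtrsim N^{-1/n},\qquad p\ne p'\in P.$$ Then for every $\varepsilon>0$ there exist pins $x_1,\dots,x_k\in P$ such that $$\bigl|\Delta^{k\text{-star}}_{x_1,\dots,x_k}(P)\bigr|\gtrsim_\varepsilon N^{\frac{k}{\alpha_+(n,k)}-\varepsilon},$$ where $$\alpha_+(n,k)=\frac{n^2+nk+k}{2n+1}.$$
   Context: $\Delta^{k\text{-star}}_{x_1,\dots,x_k}(P)=\{(|x_1-x|,\dots,|x_k-x|):x\in P\}\subset\mathbb{R}^k$, and $|\cdot|$ of a finite set is its cardinality. The separation hypothesis means $|p-p'|\ge cN^{-1/n}$ for a fixed constant $c>0$, and the implicit constant in the conclusion depends only on $\varepsilon$, $n$, $k$ and $c$ (not on $N$ or $P$). *)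

theory Defs
  imports "HOL-Analysis.Analysis"
begin

definition star_distance_set :: "(real ^ 'n) ^ 'k \<Rightarrow> (real ^ 'n) set \<Rightarrow> (real ^ 'k) set" where
  "star_distance_set x P = {(\<chi> j. norm (x $ j - p)) | p. p \<in> P}"

definition alpha_plus :: "nat \<Rightarrow> nat \<Rightarrow> real" where
  "alpha_plus n k = (real n ^ 2 + real n * real k + real k) / (2 * real n + 1)"

end

theory Submission imports Defs begin

text \<open>
  Write \<open>n\<close> for the dimension. The proof is elementary and gives the exponent
  \<open>k (2 n - k) / n^2\<close> without any loss; \<open>exponent_le\<close> compares it with \<open>k / \<alpha>\<^sub>+\<close>, the point being
  that the difference is a positive multiple of \<open>(n - k) ((k - 1) n + k)\<close>.

  Fix a radius \<open>r\<close> and count pairs \<open>x \<noteq> y\<close> of \<open>P\<close> with \<open>|x - y| < r\<close> that no pin tells apart.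

  Upper bound. By separation there are \<open>O(N^2 r^n)\<close> pairs with \<open>|x - y| < r\<close>. A pin fails to tell
  \<open>x\<close> and \<open>y\<close> apart exactly when it lies on their perpendicular bisector, and a hyperplane holds at most
  \<open>h = O(N^(1 - 1/n))\<close> points of \<open>P\<close>. Averaging over the possible pins, some pin reduces the number of
  surviving pairs by a factor \<open>O(h / N) = O(N^(-1/n))\<close>. The average may even be restricted to the pins
  outside the affine hull of those already chosen, because that hull lies in a hyperplane too. So there
  are affinely independent pins with only \<open>O(N^2 r^n N^(-k/n))\<close> surviving pairs
  (\<open>exists_pins\<close>, \<open>card_close_pairs_le\<close>).

  Lower bound. Points with the same distances to \<open>k\<close> affinely independent pins lie on a sphere of
  dimension \<open>n - k\<close>, which is covered by \<open>O(r^(k - n))\<close> sets of diameter less than \<open>r\<close>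
  (\<open>covered_equidistant\<close>). If there are \<open>D\<close> distance vectors, \<open>P\<close> therefore splits into
  \<open>O(D r^(k - n))\<close> classes, and by Cauchy-Schwarz at least \<open>N^2\<close> divided by this number of ordered
  pairs, the \<open>N\<close> diagonal ones included, lie in a common class (\<open>card_square_le_equidistant_pairs\<close>).

  Comparing the two bounds, \<open>N r^(n - k) \<le> O(D) (1 + N r^n N^(-k/n))\<close>. The choice \<open>r = N^(-(n - k) / n^2)\<close>
  makes the second summand equal to 1, that is, it balances the surviving pairs with the diagonal ones,
  and the left side becomes \<open>N\<close> to the power \<open>k (2 n - k) / n^2\<close> (\<open>balanced_radius_bound\<close>).
\<close>

section \<open>Coverings by sets of small diameter\<close>

definition covered :: "'a::metric_space set \<Rightarrow> real \<Rightarrow> real \<Rightarrow> bool" where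
  "covered S \<delta> m \<longleftrightarrow> (\<exists>\<C>. finite \<C> \<and> real (card \<C>) \<le> m \<and> S \<subseteq> \<Union>\<C> \<and>
     (\<forall>C\<in>\<C>. \<forall>x\<in>C. \<forall>y\<in>C. dist x y < \<delta>))"

lemma covered_mono:
  assumes "covered S \<delta> m" "T \<subseteq> S" "m \<le> m'"
  shows "covered T \<delta> m'"
  using assms unfolding covered_def by (meson order_trans)

lemma covered_UN:
  assumes "finite I" and "\<And>i. i \<in> I \<Longrightarrow> covered (S i) \<delta> m"
  shows "covered (\<Union>i\<in>I. S i) \<delta> (real (card I) * m)"
proof -
  obtain \<C> where C: "\<And>i. i \<in> I \<Longrightarrow> finite (\<C> i) \<and> real (card (\<C> i)) \<le> m \<and> S i \<subseteq> \<Union>(\<C> i) \<and>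
     (\<forall>C\<in>\<C> i. \<forall>x\<in>C. \<forall>y\<in>C. dist x y < \<delta>)"
    using assms(2) unfolding covered_def by metis
  have "real (card (\<Union>i\<in>I. \<C> i)) \<le> (\<Sum>i\<in>I. real (card (\<C> i)))"
    using card_UN_le[OF assms(1), of \<C>] by (metis of_nat_le_iff of_nat_sum)
  also have "\<dots> \<le> real (card I) * m"
    using sum_bounded_above[of I "\<lambda>i. real (card (\<C> i))" m] C by simp
  finally have "real (card (\<Union>i\<in>I. \<C> i)) \<le> real (card I) * m" .
  moreover have "finite (\<Union>i\<in>I. \<C> i)" using assms(1) C by simp
  moreover have "(\<Union>i\<in>I. S i) \<subseteq> \<Union>(\<Union>i\<in>I. \<C> i)"
  proof
    fix x assume "x \<in> (\<Union>i\<in>I. S i)"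
    then obtain i where "i \<in> I" "x \<in> S i" by blast
    then show "x \<in> \<Union>(\<Union>i\<in>I. \<C> i)" using C[of i] by blast
  qed
  moreover have "\<forall>C\<in>(\<Union>i\<in>I. \<C> i). \<forall>x\<in>C. \<forall>y\<in>C. dist x y < \<delta>"
    using C by simp
  ultimately show ?thesis unfolding covered_def by blast
qed

lemma covered_by_fibres:
  assumes "finite I" and "g ` S \<subseteq> I"
    and "\<And>x y. x \<in> S \<Longrightarrow> y \<in> S \<Longrightarrow> g x = g y \<Longrightarrow> dist x y < \<delta>"
  shows "covered S \<delta> (real (card I))"
proof -
  let ?C = "(\<lambda>i. {x\<in>S. g x = i}) ` I"
  have "card ?C \<le> card I" using assms(1) by (rule card_image_le)
  then show ?thesis
    unfolding covered_def using assms by (intro exI[of _ ?C]) auto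
qed

lemma card_separated_le:
  assumes "covered S \<delta> m" and sep: "\<And>x y. x \<in> S \<Longrightarrow> y \<in> S \<Longrightarrow> x \<noteq> y \<Longrightarrow> \<delta> \<le> dist x y"
  shows "real (card S) \<le> m"
proof -
  obtain \<C> where C: "finite \<C>" "real (card \<C>) \<le> m" "S \<subseteq> \<Union>\<C>"
     "\<And>C x y. C\<in>\<C> \<Longrightarrow> x\<in>C \<Longrightarrow> y\<in>C \<Longrightarrow> dist x y < \<delta>"
    using assms(1) unfolding covered_def by blast
  have "\<forall>x\<in>S. \<exists>C\<in>\<C>. x \<in> C" using C(3) by blast
  then obtain h where h: "\<And>x. x \<in> S \<Longrightarrow> h x \<in> \<C> \<and> x \<in> h x"
    unfolding bchoice_iff Bex_def by auto
  have "inj_on h S"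
  proof (rule inj_onI, rule ccontr)
    fix x y assume xy: "x \<in> S" "y \<in> S" "h x = h y" "x \<noteq> y"
    then have "dist x y < \<delta>" using h[of x] h[of y] C(4)[of "h x" x y] by simp
    then show False using sep[OF xy(1,2,4)] by simp
  qed
  moreover have "h ` S \<subseteq> \<C>" using h by blast
  ultimately have "card S \<le> card \<C>" using C(1) by (rule card_inj_on_le)
  then show ?thesis using C(2) by linarith
qed

text \<open>
  If a few coordinates in unit directions control the distance on a set, rounding these coordinates
  to a fine grid splits the set into pieces of small diameter. Both thin sets below, hyperplane
  sections and spheres, are handled this way, with as many coordinates as their dimension. The factor 2
  in the control leaves room for the coordinate that is dropped on a sphere.
\<close>

lemma covered_by_coordinates:
  fixes S :: "'a::euclidean_space set"
  assumes "finite A" and cardA: "card A \<le> m" and m: "m \<le> DIM('a)"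
    and unit: "\<And>b. b \<in> A \<Longrightarrow> norm b = 1"
    and diam: "\<And>x y. x \<in> S \<Longrightarrow> y \<in> S \<Longrightarrow> dist x y \<le> L"
    and coord: "\<And>x y. x \<in> S \<Longrightarrow> y \<in> S \<Longrightarrow> dist x y \<le> 2 * (\<Sum>b\<in>A. \<bar>b \<bullet> (x - y)\<bar>)"
    and \<delta>: "0 < \<delta>" "\<delta> \<le> L"
  shows "covered S \<delta> (((4 * real DIM('a) + 5) * L / \<delta>) ^ m)"
proof (cases "S = {}")
  case True
  then show ?thesis unfolding covered_def using \<delta> by (intro exI[of _ "{}"]) auto
next
  case False
  then obtain x0 where x0: "x0 \<in> S" by blast
  define n where "n = DIM('a)"
  \<comment> \<open>The mesh: at most \<open>n\<close> coordinate errors, doubled by the control, must stay below \<open>\<delta>\<close>; the \<open>+ 1\<close>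
    makes this strict.\<close>
  define e where "e = \<delta> / (2 * (real n + 1))"
  have e: "e > 0" using \<delta> by (simp add: e_def)
  define g where "g x = (\<lambda>b\<in>A. \<lfloor>(b \<bullet> (x - x0) + L) / e\<rfloor>)" for x
  define K where "K = \<lfloor>2 * L / e\<rfloor>"
  define I where "I = (\<Pi>\<^sub>E b\<in>A. {0..K})"
  have "K \<ge> 0" using e \<delta> by (simp add: K_def)
  have finI: "finite I" unfolding I_def using \<open>finite A\<close> by (intro finite_PiE) auto
  have inner: "\<bar>b \<bullet> (x - x0)\<bar> \<le> L" if "b \<in> A" "x \<in> S" for b x
    using Cauchy_Schwarz_ineq2[of b "x - x0"] unit[OF that(1)] diam[OF that(2) x0]
    by (simp add: dist_norm)
  have sub: "g ` S \<subseteq> I"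
  proof clarify
    fix x assume x: "x \<in> S"
    have "\<lfloor>(b \<bullet> (x - x0) + L) / e\<rfloor> \<in> {0..K}" if "b \<in> A" for b
    proof -
      have "0 \<le> b \<bullet> (x - x0) + L" "b \<bullet> (x - x0) + L \<le> 2 * L"
        using inner[OF that x] by linarith+
      then show ?thesis
        using e by (auto simp: K_def intro!: floor_mono divide_right_mono)
    qed
    then show "g x \<in> I" by (auto simp: g_def I_def)
  qed
  have close: "dist x y < \<delta>" if "x \<in> S" "y \<in> S" "g x = g y" for x y
  proof -
    have "\<bar>b \<bullet> (x - y)\<bar> \<le> e" if b: "b \<in> A" for b
    proof -
      have "\<lfloor>(b \<bullet> (x - x0) + L) / e\<rfloor> = \<lfloor>(b \<bullet> (y - x0) + L) / e\<rfloor>"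
        using fun_cong[OF \<open>g x = g y\<close>, of b] b by (simp add: g_def)
      then have "\<bar>(b \<bullet> (x - x0) + L) / e - (b \<bullet> (y - x0) + L) / e\<bar> < 1"
        by linarith
      then have "\<bar>(b \<bullet> (x - y)) / e\<bar> < 1"
        by (simp add: inner_diff_right diff_divide_distrib add_divide_distrib)
      then show ?thesis using e by (simp add: abs_divide)
    qed
    then have "(\<Sum>b\<in>A. \<bar>b \<bullet> (x - y)\<bar>) \<le> real (card A) * e"
      using sum_bounded_above[of A "\<lambda>b. \<bar>b \<bullet> (x - y)\<bar>" e] by simp
    also have "\<dots> \<le> real n * e"
      using cardA m e by (intro mult_right_mono) (auto simp: n_def)
    finally have "dist x y \<le> 2 * (real n * e)" using coord[OF that(1,2)] by linarith
    also have "\<dots> < 2 * (real n + 1) * e" using e by (simp add: algebra_simps)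
    also have "\<dots> = \<delta>" by (simp add: e_def)
    finally show ?thesis .
  qed
  have "real_of_int K + 1 \<le> 2 * L / e + 1" by (simp add: K_def)
  also have "2 * L / e + 1 = (4 * real n + 4) * (L / \<delta>) + 1"
    using \<delta> by (simp add: e_def field_simps)
  also have "\<dots> \<le> (4 * real n + 5) * L / \<delta>" using \<delta> by (simp add: field_simps)
  finally have base: "real_of_int K + 1 \<le> (4 * real n + 5) * L / \<delta>" .
  have "real (card I) = (real_of_int K + 1) ^ card A"
    using \<open>finite A\<close> \<open>K \<ge> 0\<close> by (simp add: I_def card_PiE add.commute)
  also have "\<dots> \<le> (real_of_int K + 1) ^ m"
    using cardA \<open>K \<ge> 0\<close> by (intro power_increasing) auto
  also have "\<dots> \<le> ((4 * real n + 5) * L / \<delta>) ^ m"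
    using base \<open>K \<ge> 0\<close> by (intro power_mono) auto
  finally have "real (card I) \<le> ((4 * real n + 5) * L / \<delta>) ^ m" .
  moreover have "covered S \<delta> (real (card I))"
    using finI sub close by (rule covered_by_fibres)
  ultimately show ?thesis
    using covered_mono[OF _ order_refl] unfolding n_def by blast
qed

section \<open>Orthonormal coordinates on flats and spheres\<close>

lemma norm_le_sum_orthonormal:
  fixes B :: "'a::euclidean_space set"
  assumes "pairwise orthogonal B" "\<And>b. b \<in> B \<Longrightarrow> norm b = 1" "finite B" "v \<in> span B"
  shows "norm v \<le> (\<Sum>b\<in>B. \<bar>b \<bullet> v\<bar>)"
proof -
  have "norm v = norm (\<Sum>b\<in>B. (v \<bullet> b) *\<^sub>R b)"
    using orthonormal_basis_expand[OF assms(1,2,4,3)] by simp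
  also have "\<dots> \<le> (\<Sum>b\<in>B. norm ((v \<bullet> b) *\<^sub>R b))" by (rule norm_sum)
  also have "\<dots> = (\<Sum>b\<in>B. \<bar>b \<bullet> v\<bar>)"
    using assms(2) by (intro sum.cong) (auto simp: inner_commute)
  finally show ?thesis .
qed

text \<open>
  Supplies the coordinates for a hyperplane (one normal vector) and for the flat of points equidistant
  from several pins (the differences of the pins as normal vectors).
\<close>

lemma orthonormal_basis_of_complement:
  fixes V :: "'a::euclidean_space set"
  obtains B where "pairwise orthogonal B" "\<And>b. b \<in> B \<Longrightarrow> norm b = 1" "finite B"
    "card B + dim V = DIM('a)" "span B = {y. \<forall>x\<in>V. x \<bullet> y = 0}"
proof -
  let ?W = "{y. \<forall>x\<in>V. x \<bullet> y = 0}"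
  have sub: "subspace ?W" by (auto simp: subspace_def inner_add_right)
  have eq: "{y \<in> UNIV. \<forall>x\<in>span V. orthogonal x y} = ?W"
  proof -
    have "(\<forall>x\<in>span V. orthogonal x y) \<longleftrightarrow> (\<forall>x\<in>V. x \<bullet> y = 0)" for y
      using orthogonal_to_span[of _ V y] span_base[of _ V]
      by (auto simp: orthogonal_def inner_commute)
    then show ?thesis by auto
  qed
  have dimW: "dim ?W + dim V = DIM('a)"
    using dim_subspace_orthogonal_to_vectors[of "span V" UNIV] eq by simp
  obtain B where B: "B \<subseteq> ?W" "pairwise orthogonal B" "\<And>x. x \<in> B \<Longrightarrow> norm x = 1"
      "independent B" "card B = dim ?W" "span B = ?W"
    by (rule orthonormal_basis_subspace[OF sub]) (rule that; blast)
  show thesis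
    using that[OF B(2,3) finiteI_independent[OF B(4)]] dimW B(5,6) by simp
qed

lemma covered_hyperplane:
  fixes S :: "'a::euclidean_space set"
  assumes "u \<noteq> 0" and "S \<subseteq> {x. u \<bullet> x = t}"
    and diam: "\<And>x y. x \<in> S \<Longrightarrow> y \<in> S \<Longrightarrow> dist x y \<le> L"
    and \<delta>: "0 < \<delta>" "\<delta> \<le> L"
  shows "covered S \<delta> (((4 * real DIM('a) + 5) * L / \<delta>) ^ (DIM('a) - 1))"
proof -
  obtain B :: "'a set" where B: "pairwise orthogonal B" "\<And>b. b \<in> B \<Longrightarrow> norm b = 1" "finite B"
    "card B + dim {u} = DIM('a)" "span B = {y. \<forall>x\<in>{u}. x \<bullet> y = 0}"
    using orthonormal_basis_of_complement[of "{u}"] by blast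
  have coord: "dist x y \<le> 2 * (\<Sum>b\<in>B. \<bar>b \<bullet> (x - y)\<bar>)" if "x \<in> S" "y \<in> S" for x y
  proof -
    have "u \<bullet> x = t" "u \<bullet> y = t" using that assms(2) by auto
    then have "x - y \<in> span B" by (simp add: B(5) inner_diff_right)
    from norm_le_sum_orthonormal[OF B(1-3) this]
    have "dist x y \<le> (\<Sum>b\<in>B. \<bar>b \<bullet> (x - y)\<bar>)" by (simp add: dist_norm)
    moreover have "0 \<le> (\<Sum>b\<in>B. \<bar>b \<bullet> (x - y)\<bar>)" by (simp add: sum_nonneg)
    ultimately show ?thesis by linarith
  qed
  have "card B \<le> DIM('a) - 1"
    using B(4) assms(1) by (simp add: dim_singleton)
  from B(3) this diff_le_self B(2) diam coord \<delta> show ?thesis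
    by (rule covered_by_coordinates)
qed

lemma covered_bounded:
  fixes S :: "'a::euclidean_space set"
  assumes diam: "\<And>x y. x \<in> S \<Longrightarrow> y \<in> S \<Longrightarrow> dist x y \<le> L"
    and \<delta>: "0 < \<delta>" "\<delta> \<le> L"
  shows "covered S \<delta> (((4 * real DIM('a) + 5) * L / \<delta>) ^ DIM('a))"
proof -
  have coord: "dist x y \<le> 2 * (\<Sum>b\<in>Basis. \<bar>b \<bullet> (x - y)\<bar>)" for x y :: 'a
  proof -
    have "dist x y \<le> (\<Sum>b\<in>Basis. \<bar>b \<bullet> (x - y)\<bar>)"
      using norm_le_l1[of "x - y"] by (simp add: dist_norm inner_commute)
    moreover have "0 \<le> (\<Sum>b\<in>Basis. \<bar>b \<bullet> (x - y)\<bar>)" by (simp add: sum_nonneg)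
    ultimately show ?thesis by linarith
  qed
  show ?thesis
    using finite_Basis order_refl order_refl norm_Basis diam coord \<delta>
    by (rule covered_by_coordinates)
qed

text \<open>
  Near a point of a sphere where \<open>a\<close> is the coordinate of largest modulus and its sign is fixed, the
  sphere is a graph over the other coordinates with Lipschitz constant 1 for the \<open>\<ell>\<^sub>1\<close> norm: in
  \<open>|u\<^sub>a - v\<^sub>a| |u\<^sub>a + v\<^sub>a| \<le> \<Sum>\<^sub>b |u\<^sub>b - v\<^sub>b| |u\<^sub>b + v\<^sub>b|\<close>, which holds because the sums of squares agree,
  the factor \<open>|u\<^sub>a + v\<^sub>a|\<close> dominates every \<open>|u\<^sub>b + v\<^sub>b|\<close>. The radius does not enter.
\<close>

lemma sphere_coordinate_lipschitz:
  fixes u v :: "'b \<Rightarrow> real"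
  assumes "finite B" "a \<in> B" and sq: "(\<Sum>b\<in>B. (u b)\<^sup>2) = (\<Sum>b\<in>B. (v b)\<^sup>2)"
    and s: "\<bar>s\<bar> = 1"
    and u: "\<And>b. b \<in> B \<Longrightarrow> \<bar>u b\<bar> \<le> s * u a" and v: "\<And>b. b \<in> B \<Longrightarrow> \<bar>v b\<bar> \<le> s * v a"
  shows "\<bar>u a - v a\<bar> \<le> (\<Sum>b\<in>B - {a}. \<bar>u b - v b\<bar>)"
proof -
  let ?w = "s * u a + s * v a"
  have "\<bar>u a\<bar> \<le> s * u a" "\<bar>v a\<bar> \<le> s * v a" using u v assms(2) by auto
  then have w0: "?w \<ge> 0" by linarith
  have "\<bar>u a - v a\<bar> * ?w = \<bar>(u a)\<^sup>2 - (v a)\<^sup>2\<bar>"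
  proof -
    have "?w = \<bar>u a + v a\<bar>"
      using w0 s by (metis abs_mult abs_of_nonneg distrib_left mult_1)
    then show ?thesis by (simp add: abs_mult[symmetric] power2_eq_square algebra_simps)
  qed
  also have "(u a)\<^sup>2 - (v a)\<^sup>2 = - (\<Sum>b\<in>B - {a}. (u b)\<^sup>2 - (v b)\<^sup>2)"
    using sq assms(1,2) by (simp add: sum.remove sum_subtractf)
  also have "\<bar>\<dots>\<bar> \<le> (\<Sum>b\<in>B - {a}. \<bar>(u b)\<^sup>2 - (v b)\<^sup>2\<bar>)" by (simp add: sum_abs)
  also have "\<dots> \<le> (\<Sum>b\<in>B - {a}. \<bar>u b - v b\<bar> * ?w)"
  proof (rule sum_mono)
    fix b assume "b \<in> B - {a}"
    then have "\<bar>u b + v b\<bar> \<le> ?w" using u[of b] v[of b] by auto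
    then have "\<bar>u b - v b\<bar> * \<bar>u b + v b\<bar> \<le> \<bar>u b - v b\<bar> * ?w" by (simp add: mult_left_mono)
    then show "\<bar>(u b)\<^sup>2 - (v b)\<^sup>2\<bar> \<le> \<bar>u b - v b\<bar> * ?w"
      by (simp add: abs_mult[symmetric] power2_eq_square algebra_simps)
  qed
  also have "\<dots> = (\<Sum>b\<in>B - {a}. \<bar>u b - v b\<bar>) * ?w" by (simp add: sum_distrib_right)
  finally have main: "\<bar>u a - v a\<bar> * ?w \<le> (\<Sum>b\<in>B - {a}. \<bar>u b - v b\<bar>) * ?w" .
  show ?thesis
  proof (cases "?w = 0")
    case True
    then have "u a = 0" "v a = 0"
      using \<open>\<bar>u a\<bar> \<le> s * u a\<close> \<open>\<bar>v a\<bar> \<le> s * v a\<close> by linarith+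
    then show ?thesis by (simp add: sum_nonneg)
  next
    case False
    then show ?thesis using main w0 by simp
  qed
qed

text \<open>
  The sphere is cut into \<open>2 (m + 1)\<close> pieces, according to which coordinate dominates and with which
  sign; on each piece the dominating coordinate is redundant, leaving \<open>m\<close> coordinates. The centre \<open>p\<close>
  need not lie in the flat of the sphere: subtracting a constant from the squared distance moves it there.
\<close>

lemma covered_sphere:
  fixes S B :: "'a::euclidean_space set"
  assumes B: "pairwise orthogonal B" "\<And>b. b \<in> B \<Longrightarrow> norm b = 1" "finite B"
    and cardB: "card B = Suc m" and m: "Suc m \<le> DIM('a)"
    and span: "\<And>x y. x \<in> S \<Longrightarrow> y \<in> S \<Longrightarrow> x - y \<in> span B"
    and sphere: "\<And>x y. x \<in> S \<Longrightarrow> y \<in> S \<Longrightarrow> dist p x = dist p y"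
    and diam: "\<And>x y. x \<in> S \<Longrightarrow> y \<in> S \<Longrightarrow> dist x y \<le> L"
    and \<delta>: "0 < \<delta>" "\<delta> \<le> L"
  shows "covered S \<delta> (2 * real DIM('a) * ((4 * real DIM('a) + 5) * L / \<delta>) ^ m)"
proof -
  let ?M = "((4 * real DIM('a) + 5) * L / \<delta>) ^ m"
  have "?M \<ge> 0" using \<delta> by simp
  define I where "I = B \<times> {1, -1::real}"
  define piece where
    "piece i = {x\<in>S. \<forall>b\<in>B. \<bar>b \<bullet> (x - p)\<bar> \<le> snd i * (fst i \<bullet> (x - p))}" for i :: "'a \<times> real"
  have "B \<noteq> {}" using cardB by auto
  have "S \<subseteq> (\<Union>i\<in>I. piece i)"
  proof
    fix x assume x: "x \<in> S"
    obtain a where "a \<in> B" and max: "Max ((\<lambda>b. \<bar>b \<bullet> (x - p)\<bar>) ` B) = \<bar>a \<bullet> (x - p)\<bar>"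
      using obtains_MAX[OF \<open>finite B\<close> \<open>B \<noteq> {}\<close>] by metis
    then have a: "a \<in> B" "\<And>b. b \<in> B \<Longrightarrow> \<bar>b \<bullet> (x - p)\<bar> \<le> \<bar>a \<bullet> (x - p)\<bar>"
      using \<open>finite B\<close> by (auto simp flip: max)
    define s where "s = (if a \<bullet> (x - p) \<ge> 0 then 1 else - 1 :: real)"
    have "x \<in> piece (a, s)" using x a by (auto simp: piece_def s_def)
    moreover have "(a, s) \<in> I" using a by (auto simp: I_def s_def)
    ultimately show "x \<in> (\<Union>i\<in>I. piece i)" by blast
  qed
  moreover have "covered (piece i) \<delta> ?M" if "i \<in> I" for i
  proof -
    obtain a s where i: "i = (a, s)" by (cases i)
    have a: "a \<in> B" and s: "\<bar>s\<bar> = 1" using that by (auto simp: I_def i)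
    have coord: "dist x y \<le> 2 * (\<Sum>b\<in>B - {a}. \<bar>b \<bullet> (x - y)\<bar>)"
      if "x \<in> piece i" "y \<in> piece i" for x y
      proof -
        have xy: "x \<in> S" "y \<in> S" using that by (auto simp: piece_def)
        \<comment> \<open>As \<open>x - y\<close> lies in the span, the components of \<open>x - p\<close> and \<open>y - p\<close> orthogonal to it agree,
          so equal distances to \<open>p\<close> mean equal sums of squared coordinates.\<close>
        have "(\<Sum>b\<in>B. (b \<bullet> (x - p))\<^sup>2) - (\<Sum>b\<in>B. (b \<bullet> (y - p))\<^sup>2)
            = (\<Sum>b\<in>B. ((x - y) \<bullet> b) * (b \<bullet> ((x - p) + (y - p))))"
          by (simp add: sum_subtractf[symmetric] power2_eq_square inner_diff_right inner_diff_left
               inner_add_right inner_commute algebra_simps)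
        also have "\<dots> = (\<Sum>b\<in>B. ((x - y) \<bullet> b) *\<^sub>R b) \<bullet> ((x - p) + (y - p))"
          by (simp add: inner_sum_left)
        also have "\<dots> = (x - y) \<bullet> ((x - p) + (y - p))"
          using orthonormal_basis_expand[OF B(1,2) span[OF xy] B(3)] by simp
        also have "\<dots> = (norm (x - p))\<^sup>2 - (norm (y - p))\<^sup>2"
          by (simp add: power2_norm_eq_inner inner_diff_right inner_diff_left
               inner_add_right inner_commute algebra_simps)
        also have "\<dots> = 0" using sphere[OF xy] by (simp add: dist_norm norm_minus_commute)
        finally have sq: "(\<Sum>b\<in>B. (b \<bullet> (x - p))\<^sup>2) = (\<Sum>b\<in>B. (b \<bullet> (y - p))\<^sup>2)" by simp
        have "\<bar>a \<bullet> (x - p) - a \<bullet> (y - p)\<bar> \<le> (\<Sum>b\<in>B - {a}. \<bar>b \<bullet> (x - p) - b \<bullet> (y - p)\<bar>)"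
          using that by (intro sphere_coordinate_lipschitz[OF B(3) a sq s]) (auto simp: piece_def i)
        then have "\<bar>a \<bullet> (x - y)\<bar> \<le> (\<Sum>b\<in>B - {a}. \<bar>b \<bullet> (x - y)\<bar>)"
          by (simp add: inner_diff_right)
        moreover have "dist x y \<le> \<bar>a \<bullet> (x - y)\<bar> + (\<Sum>b\<in>B - {a}. \<bar>b \<bullet> (x - y)\<bar>)"
          using norm_le_sum_orthonormal[OF B(1-3) span[OF xy]] B(3) a
          by (simp add: dist_norm sum.remove)
        ultimately show ?thesis by linarith
      qed
    have "finite (B - {a})" "card (B - {a}) \<le> m" "m \<le> DIM('a)"
      using B(3) a cardB m by (auto simp: card_Diff_singleton)
    moreover have "norm b = 1" if "b \<in> B - {a}" for b using B(2) that by simp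
    moreover have "dist x y \<le> L" if "x \<in> piece i" "y \<in> piece i" for x y
      using diam that by (simp add: piece_def)
    ultimately show ?thesis using coord \<delta> by (rule covered_by_coordinates)
  qed
  moreover have "finite I" using B(3) by (simp add: I_def)
  ultimately have "covered S \<delta> (real (card I) * ?M)"
    using covered_mono[OF covered_UN[of I piece \<delta> ?M] _ order_refl] by simp
  moreover have "card I = 2 * Suc m" using cardB B(3) by (simp add: I_def card_cartesian_product)
  moreover have "real (2 * Suc m) * ?M \<le> 2 * real DIM('a) * ?M"
    using m \<open>?M \<ge> 0\<close> by (intro mult_right_mono) auto
  ultimately show ?thesis
    using covered_mono[of S \<delta> "real (2 * Suc m) * ?M" S] by simp
qed

text \<open>
  Subtracting the equations of two spheres leaves a linear equation, so points with the same distances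
  to all pins of \<open>Q\<close> differ by vectors orthogonal to all differences of pins. Affine independence of \<open>Q\<close>,
  here expressed through \<open>aff_dim\<close>, makes this a space of dimension \<open>n - card Q + 1\<close>.
\<close>

lemma covered_equidistant:
  fixes S Q :: "'a::euclidean_space set"
  assumes "finite Q" "Q \<noteq> {}" "aff_dim Q = int (card Q) - 1" "card Q \<le> DIM('a)"
    and equi: "\<And>p x y. p \<in> Q \<Longrightarrow> x \<in> S \<Longrightarrow> y \<in> S \<Longrightarrow> dist p x = dist p y"
    and diam: "\<And>x y. x \<in> S \<Longrightarrow> y \<in> S \<Longrightarrow> dist x y \<le> L"
    and \<delta>: "0 < \<delta>" "\<delta> \<le> L"
  shows "covered S \<delta> (2 * real DIM('a) * ((4 * real DIM('a) + 5) * L / \<delta>) ^ (DIM('a) - card Q))"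
proof -
  obtain p where p: "p \<in> Q" using assms(2) by blast
  let ?V = "(\<lambda>x. x - p) ` Q"
  obtain B :: "'a set" where B: "pairwise orthogonal B" "\<And>b. b \<in> B \<Longrightarrow> norm b = 1" "finite B"
    "card B + dim ?V = DIM('a)" "span B = {y. \<forall>x\<in>?V. x \<bullet> y = 0}"
    using orthonormal_basis_of_complement[of ?V] by blast
  have "int (dim ?V) = int (card Q) - 1"
    using aff_dim_eq_dim_subtract[of p Q] p assms(3) by (simp add: hull_inc)
  moreover have "card Q > 0" using assms(1,2) by (simp add: card_gt_0_iff)
  ultimately have cardB: "card B = Suc (DIM('a) - card Q)" using B(4) assms(4) by linarith
  have span: "x - y \<in> span B" if "x \<in> S" "y \<in> S" for x y
  proof -
    have "(q - p) \<bullet> (x - y) = 0" if q: "q \<in> Q" for q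
    proof -
      have "(dist q x)\<^sup>2 - (dist q y)\<^sup>2 - ((dist p x)\<^sup>2 - (dist p y)\<^sup>2) = - 2 * ((q - p) \<bullet> (x - y))"
        by (simp add: dist_norm power2_norm_eq_inner inner_diff_left inner_diff_right
            inner_commute algebra_simps)
      then show ?thesis using equi[OF p \<open>x \<in> S\<close> \<open>y \<in> S\<close>] equi[OF q \<open>x \<in> S\<close> \<open>y \<in> S\<close>] by simp
    qed
    then show ?thesis by (simp add: B(5))
  qed
  have "Suc (DIM('a) - card Q) \<le> DIM('a)" using \<open>card Q > 0\<close> assms(4) by linarith
  with B(1-3) cardB show ?thesis
    using span equi[OF p] diam \<delta> by (rule covered_sphere)
qed


section \<open>Counting pairs that the pins do not tell apart\<close>

definition equidistant_pairs :: "'a::metric_space set \<Rightarrow> real \<Rightarrow> 'a set \<Rightarrow> ('a \<times> 'a) set" where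
  "equidistant_pairs P r Q = {(x, y). x \<in> P \<and> y \<in> P \<and> x \<noteq> y \<and> dist x y < r \<and> (\<forall>p\<in>Q. dist p x = dist p y)}"

lemma finite_equidistant_pairs [simp]: "finite P \<Longrightarrow> finite (equidistant_pairs P r Q)"
  by (rule finite_subset[of _ "P \<times> P"]) (auto simp: equidistant_pairs_def)

lemma card_square_le_same_class:
  assumes "finite P" "finite I" "g ` P \<subseteq> I"
  shows "real (card P) ^ 2 \<le> real (card I) * real (card {(x, y). x \<in> P \<and> y \<in> P \<and> g x = g y})"
proof -
  define K where "K i = {x\<in>P. g x = i}" for i
  have finK: "finite (K i)" for i using assms(1) by (simp add: K_def)
  have "P = (\<Union>i\<in>I. K i)" using assms(3) by (auto simp: K_def)
  moreover have "card (\<Union>i\<in>I. K i) = (\<Sum>i\<in>I. card (K i))"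
    using assms(2) finK by (intro card_UN_disjoint) (auto simp: K_def)
  ultimately have P: "card P = (\<Sum>i\<in>I. card (K i))" by simp
  have "{(x, y). x \<in> P \<and> y \<in> P \<and> g x = g y} = (\<Union>i\<in>I. K i \<times> K i)"
    using assms(3) by (auto simp: K_def)
  moreover have "card (\<Union>i\<in>I. K i \<times> K i) = (\<Sum>i\<in>I. card (K i \<times> K i))"
    using assms(2) finK by (intro card_UN_disjoint) (auto simp: K_def)
  ultimately have pairs: "card {(x, y). x \<in> P \<and> y \<in> P \<and> g x = g y} = (\<Sum>i\<in>I. card (K i) ^ 2)"
    by (simp add: card_cartesian_product power2_eq_square)
  show ?thesis
    using sum_squared_le_sum_of_squares[of "\<lambda>i. real (card (K i))" I]
    unfolding P pairs by (simp add: mult.commute)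
qed

text \<open>
  Cauchy-Schwarz for the classes of \<open>P\<close> given by the value of \<open>f\<close> together with a member of the
  covering of that fibre.
\<close>

lemma card_square_le_close_pairs:
  assumes "finite P" "m \<ge> 0"
    and cov: "\<And>v. v \<in> f ` P \<Longrightarrow> covered {x\<in>P. f x = v} r m"
  shows "real (card P) ^ 2
    \<le> real (card (f ` P)) * m * real (card {(x, y). x \<in> P \<and> y \<in> P \<and> f x = f y \<and> dist x y < r})"
proof -
  have "\<forall>v\<in>f ` P. \<exists>\<C>. finite \<C> \<and> real (card \<C>) \<le> m \<and> {x\<in>P. f x = v} \<subseteq> \<Union>\<C> \<and>
     (\<forall>C\<in>\<C>. \<forall>x\<in>C. \<forall>y\<in>C. dist x y < r)"
    by (rule ballI) (rule cov[unfolded covered_def])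
  from bchoice[OF this] obtain \<C> where C: "\<forall>v\<in>f ` P. finite (\<C> v) \<and> real (card (\<C> v)) \<le> m \<and>
      {x\<in>P. f x = v} \<subseteq> \<Union>(\<C> v) \<and> (\<forall>C\<in>\<C> v. \<forall>x\<in>C. \<forall>y\<in>C. dist x y < r)"
    ..
  have "\<forall>x\<in>P. \<exists>C. C \<in> \<C> (f x) \<and> x \<in> C"
  proof
    fix x assume "x \<in> P"
    then have "{y\<in>P. f y = f x} \<subseteq> \<Union>(\<C> (f x))" using C by simp
    with \<open>x \<in> P\<close> show "\<exists>C. C \<in> \<C> (f x) \<and> x \<in> C" by blast
  qed
  from bchoice[OF this] obtain h where h: "\<forall>x\<in>P. h x \<in> \<C> (f x) \<and> x \<in> h x" ..
  define I where "I = Sigma (f ` P) \<C>"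
  define g where "g x = (f x, h x)" for x
  have finI: "finite I" unfolding I_def using assms(1) C by (intro finite_SigmaI) auto
  have "real (card I) = (\<Sum>v\<in>f ` P. real (card (\<C> v)))"
    unfolding I_def using assms(1) C by (subst card_SigmaI) auto
  also have "\<dots> \<le> real (card (f ` P)) * m"
    using sum_bounded_above[of "f ` P" "\<lambda>v. real (card (\<C> v))" m] C by simp
  finally have cardI: "real (card I) \<le> real (card (f ` P)) * m" .
  let ?G = "{(x, y). x \<in> P \<and> y \<in> P \<and> g x = g y}"
  let ?F = "{(x, y). x \<in> P \<and> y \<in> P \<and> f x = f y \<and> dist x y < r}"
  have "?G \<subseteq> ?F"
  proof clarify
    fix x y assume xy: "x \<in> P" "y \<in> P" "g x = g y"
    then have fh: "f x = f y" "h x = h y" by (auto simp: g_def)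
    have "\<forall>C\<in>\<C> (f x). \<forall>y\<in>C. \<forall>z\<in>C. dist y z < r" using C xy(1) by simp
    moreover have "h x \<in> \<C> (f x)" "x \<in> h x" "y \<in> h x" using h xy(1,2) fh by auto
    ultimately have "dist x y < r" by blast
    with fh show "f x = f y \<and> dist x y < r" by simp
  qed
  moreover have "finite ?F" by (rule finite_subset[of _ "P \<times> P"]) (use assms(1) in auto)
  ultimately have "card ?G \<le> card ?F" by (intro card_mono)
  have "g ` P \<subseteq> I" using h by (auto simp: I_def g_def)
  then have "real (card P) ^ 2 \<le> real (card I) * real (card ?G)"
    by (rule card_square_le_same_class[OF assms(1) finI])
  also have "\<dots> \<le> (real (card (f ` P)) * m) * real (card ?F)"
    using cardI \<open>card ?G \<le> card ?F\<close> assms(2) by (intro mult_mono) auto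
  finally show ?thesis .
qed

lemma card_square_le_equidistant_pairs:
  fixes P Q :: "'a::euclidean_space set"
  assumes "finite P" "finite Q" "Q \<noteq> {}" "aff_dim Q = int (card Q) - 1" "card Q \<le> DIM('a)"
    and f: "\<And>p x y. p \<in> Q \<Longrightarrow> x \<in> P \<Longrightarrow> y \<in> P \<Longrightarrow> f x = f y \<Longrightarrow> dist p x = dist p y"
    and diam: "\<And>x y. x \<in> P \<Longrightarrow> y \<in> P \<Longrightarrow> dist x y \<le> L"
    and r: "0 < r" "r \<le> L"
  shows "real (card P) ^ 2 \<le> real (card (f ` P))
      * (2 * real DIM('a) * ((4 * real DIM('a) + 5) * L / r) ^ (DIM('a) - card Q))
      * (real (card P) + real (card (equidistant_pairs P r Q)))"
    (is "_ \<le> _ * ?M * _")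
proof -
  have "covered {x\<in>P. f x = v} r ?M" for v
    using assms(2-5) _ _ r
  proof (rule covered_equidistant)
    show "dist p x = dist p y" if "p \<in> Q" "x \<in> {x\<in>P. f x = v}" "y \<in> {x\<in>P. f x = v}" for p x y
      using f[of p x y] that by simp
    show "dist x y \<le> L" if "x \<in> {x\<in>P. f x = v}" "y \<in> {x\<in>P. f x = v}" for x y
      using diam that by simp
  qed
  moreover have M: "?M \<ge> 0" using r by simp
  ultimately have main: "real (card P) ^ 2 \<le> real (card (f ` P)) * ?M
      * real (card {(x, y). x \<in> P \<and> y \<in> P \<and> f x = f y \<and> dist x y < r})" (is "_ \<le> _ * real (card ?F)")
    by (intro card_square_le_close_pairs assms(1))
  have "?F \<subseteq> (\<lambda>x. (x, x)) ` P \<union> equidistant_pairs P r Q"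
    using f by (auto simp: equidistant_pairs_def)
  then have "card ?F \<le> card ((\<lambda>x. (x, x)) ` P \<union> equidistant_pairs P r Q)"
    using assms(1) by (intro card_mono) auto
  also have "\<dots> \<le> card ((\<lambda>x. (x, x)) ` P) + card (equidistant_pairs P r Q)" by (rule card_Un_le)
  also have "\<dots> \<le> card P + card (equidistant_pairs P r Q)"
    using assms(1) by (simp add: card_image_le)
  finally have "real (card ?F) \<le> real (card P) + real (card (equidistant_pairs P r Q))" by linarith
  then have "real (card (f ` P)) * ?M * real (card ?F)
    \<le> real (card (f ` P)) * ?M * (real (card P) + real (card (equidistant_pairs P r Q)))"
    using M by (intro mult_left_mono) auto
  with main show ?thesis by linarith
qed

text \<open>
  Double counting: the pins that fail on a given pair lie on its perpendicular bisector, so each pair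
  is missed by at most \<open>h\<close> of the at least \<open>a\<close> candidates.
\<close>

lemma exists_refining_pin:
  fixes P :: "'a::euclidean_space set"
  assumes "finite P" "A \<subseteq> P" "G \<subseteq> P \<times> P" and offdiag: "\<And>x y. (x, y) \<in> G \<Longrightarrow> x \<noteq> y"
    and hyp: "\<And>u t. u \<noteq> 0 \<Longrightarrow> real (card {p\<in>P. u \<bullet> p = t}) \<le> h"
    and A: "real (card A) \<ge> a" "a > 0"
  shows "\<exists>p\<in>A. real (card {(x, y). (x, y) \<in> G \<and> dist p x = dist p y}) \<le> real (card G) * (h / a)"
proof (rule ccontr)
  assume "\<not> ?thesis"
  then have large: "real (card G) * (h / a) < real (card {z\<in>G. dist p (fst z) = dist p (snd z)})"
    if "p \<in> A" for p using that by (auto simp: not_le case_prod_unfold)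
  have finA: "finite A" "A \<noteq> {}" and finG: "finite G"
    using assms(1-3) A finite_subset by (auto, blast)
  have bisector: "real (card {p\<in>A. dist p x = dist p y}) \<le> h" if "(x, y) \<in> G" for x y
  proof -
    have "{p\<in>A. dist p x = dist p y} \<subseteq> {p\<in>P. (x - y) \<bullet> p = (x \<bullet> x - y \<bullet> y) / 2}"
    proof clarify
      fix p assume p: "p \<in> A" "dist p x = dist p y"
      then have "(dist p x)\<^sup>2 = (dist p y)\<^sup>2" by simp
      then show "p \<in> P \<and> (x - y) \<bullet> p = (x \<bullet> x - y \<bullet> y) / 2"
        using p(1) assms(2)
        by (auto simp: dist_norm power2_norm_eq_inner inner_diff_left inner_diff_right inner_commute)
    qed
    then have "card {p\<in>A. dist p x = dist p y} \<le> card {p\<in>P. (x - y) \<bullet> p = (x \<bullet> x - y \<bullet> y) / 2}"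
      using assms(1) by (intro card_mono) auto
    also have "real \<dots> \<le> h" using offdiag[OF that] by (intro hyp) auto
    finally show ?thesis by simp
  qed
  have "real (card G) * h = a * (real (card G) * (h / a))" using A(2) by simp
  also have "\<dots> \<le> real (card A) * (real (card G) * (h / a))"
  proof (cases "G = {}")
    case False
    then obtain x y where "(x, y) \<in> G" by auto
    from bisector[OF this] have "h \<ge> 0" using of_nat_0_le_iff order_trans by blast
    then show ?thesis using A by (intro mult_right_mono) auto
  qed simp
  also have "\<dots> = (\<Sum>p\<in>A. real (card G) * (h / a))" by simp
  also have "\<dots> < (\<Sum>p\<in>A. real (card {z\<in>G. dist p (fst z) = dist p (snd z)}))"
    using large finA by (intro sum_strict_mono) auto
  also have "\<dots> = real (\<Sum>z\<in>G. card {p\<in>A. dist p (fst z) = dist p (snd z)})"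
    using sum_multicount_gen[OF finA(1) finG, of "\<lambda>p z. dist p (fst z) = dist p (snd z)"
        "\<lambda>z. card {p\<in>A. dist p (fst z) = dist p (snd z)}"] by (simp flip: of_nat_sum)
  also have "\<dots> \<le> real (card G) * h"
    using sum_bounded_above[of G "\<lambda>z. real (card {p\<in>A. dist p (fst z) = dist p (snd z)})" h]
      bisector by auto
  finally show False by simp
qed

text \<open>
  The pins are chosen one at a time outside the affine hull of their predecessors. As \<open>2 h \<le> card P\<close>, at
  least half of \<open>P\<close> stays available, which is the source of the factor 2.
\<close>

lemma exists_pins:
  fixes P :: "'a::euclidean_space set"
  assumes "finite P" "P \<noteq> {}"
    and hyp: "\<And>u t. u \<noteq> 0 \<Longrightarrow> real (card {p\<in>P. u \<bullet> p = t}) \<le> h"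
    and h: "2 * h \<le> real (card P)" and "k \<le> DIM('a)"
  shows "\<exists>Q. Q \<subseteq> P \<and> card Q = k \<and> aff_dim Q = int k - 1 \<and>
    real (card (equidistant_pairs P r Q))
      \<le> real (card (equidistant_pairs P r {})) * (2 * h / real (card P)) ^ k"
  using \<open>k \<le> DIM('a)\<close>
proof (induction k)
  case 0
  show ?case by (intro exI[of _ "{}"]) auto
next
  case (Suc k)
  then obtain Q where Q: "Q \<subseteq> P" "card Q = k" "aff_dim Q = int k - 1"
    "real (card (equidistant_pairs P r Q))
      \<le> real (card (equidistant_pairs P r {})) * (2 * h / real (card P)) ^ k"
    by auto
  have N: "real (card P) > 0" using assms(1,2) by (simp add: card_gt_0_iff)
  have h0: "h \<ge> 0"
  proof -
    obtain u :: 'a where "u \<noteq> 0" using norm_some_Basis by fastforce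
    from hyp[OF this, of 0] show ?thesis using of_nat_0_le_iff order_trans by blast
  qed
  define A where "A = P - affine hull Q"
  have "aff_dim (affine hull Q) < int DIM('a)" using Q(3) Suc.prems by simp
  then obtain u t where u: "u \<noteq> 0" "affine hull Q \<subseteq> {x. u \<bullet> x = t}"
    by (rule aff_lowdim_subset_hyperplane)
  have "card P \<le> card (A \<union> {p\<in>P. u \<bullet> p = t})"
    using assms(1) u(2) by (intro card_mono) (auto simp: A_def)
  also have "\<dots> \<le> card A + card {p\<in>P. u \<bullet> p = t}" by (rule card_Un_le)
  finally have "real (card P) \<le> real (card A) + h" using hyp[OF u(1), of t] by linarith
  then have A: "real (card A) \<ge> real (card P) / 2" using h by linarith
  let ?G = "equidistant_pairs P r Q"
  have "\<exists>p\<in>A. real (card {(x, y). (x, y) \<in> ?G \<and> dist p x = dist p y})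
      \<le> real (card ?G) * (h / (real (card P) / 2))"
    using assms(1) _ _ _ hyp A
  proof (rule exists_refining_pin)
    show "A \<subseteq> P" by (auto simp: A_def)
  qed (use N in \<open>auto simp: equidistant_pairs_def\<close>)
  then obtain p where p: "p \<in> A"
    "real (card {(x, y). (x, y) \<in> ?G \<and> dist p x = dist p y}) \<le> real (card ?G) * (2 * h / real (card P))"
    by (auto simp: mult.commute)
  have eq: "equidistant_pairs P r (insert p Q) = {(x, y). (x, y) \<in> ?G \<and> dist p x = dist p y}"
    by (auto simp: equidistant_pairs_def)
  have "p \<notin> Q" using p(1) hull_inc[of p Q] by (auto simp: A_def)
  moreover have "finite Q" using Q(1) assms(1) finite_subset by blast
  ultimately have "card (insert p Q) = Suc k" using Q(2) by simp
  moreover have "aff_dim (insert p Q) = int (Suc k) - 1"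
    using p(1) Q(3) by (simp add: aff_dim_insert A_def)
  moreover have "real (card (equidistant_pairs P r (insert p Q)))
      \<le> real (card (equidistant_pairs P r {})) * (2 * h / real (card P)) ^ Suc k"
  proof -
    have "real (card ?G) * (2 * h / real (card P))
      \<le> real (card (equidistant_pairs P r {})) * (2 * h / real (card P)) ^ k * (2 * h / real (card P))"
      using Q(4) h0 by (intro mult_right_mono) auto
    with p(2) show ?thesis unfolding eq power_Suc2 mult.assoc by (rule order_trans)
  qed
  ultimately show ?case
    using Q(1) p(1) by (intro exI[of _ "insert p Q"]) (auto simp: A_def)
qed

section \<open>Separated sets\<close>

lemma card_hyperplane_section_le:
  fixes P :: "'a::euclidean_space set"
  assumes sep: "\<And>x y. x \<in> P \<Longrightarrow> y \<in> P \<Longrightarrow> x \<noteq> y \<Longrightarrow> \<sigma> \<le> dist x y"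
    and diam: "\<And>x y. x \<in> P \<Longrightarrow> y \<in> P \<Longrightarrow> dist x y \<le> L"
    and \<sigma>: "0 < \<sigma>" "\<sigma> \<le> L" and "u \<noteq> 0"
  shows "real (card {p\<in>P. u \<bullet> p = t}) \<le> ((4 * real DIM('a) + 5) * L / \<sigma>) ^ (DIM('a) - 1)"
proof (rule card_separated_le)
  show "covered {p\<in>P. u \<bullet> p = t} \<sigma> (((4 * real DIM('a) + 5) * L / \<sigma>) ^ (DIM('a) - 1))"
    using \<open>u \<noteq> 0\<close> _ _ \<sigma>
  proof (rule covered_hyperplane)
    show "{p\<in>P. u \<bullet> p = t} \<subseteq> {x. u \<bullet> x = t}" by blast
  qed (use diam in simp)
qed (use sep in simp)

lemma card_close_pairs_le:
  fixes P :: "'a::euclidean_space set"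
  assumes "finite P"
    and sep: "\<And>x y. x \<in> P \<Longrightarrow> y \<in> P \<Longrightarrow> x \<noteq> y \<Longrightarrow> \<sigma> \<le> dist x y"
    and \<sigma>: "0 < \<sigma>" "\<sigma> \<le> 2 * r"
  shows "real (card (equidistant_pairs P r {}))
    \<le> real (card P) * ((4 * real DIM('a) + 5) * (2 * r) / \<sigma>) ^ DIM('a)"
proof -
  let ?M = "((4 * real DIM('a) + 5) * (2 * r) / \<sigma>) ^ DIM('a)"
  define S where "S x = {y\<in>P. dist x y < r}" for x
  have S: "real (card (S x)) \<le> ?M" for x
  proof (rule card_separated_le)
    show "covered (S x) \<sigma> ?M"
      using _ \<sigma>
    proof (rule covered_bounded)
      show "dist y z \<le> 2 * r" if "y \<in> S x" "z \<in> S x" for y z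
        using dist_triangle3[of y z x] that by (simp add: S_def)
    qed
  qed (use sep in \<open>simp add: S_def\<close>)
  have "equidistant_pairs P r {} \<subseteq> Sigma P S" by (auto simp: equidistant_pairs_def S_def)
  then have "card (equidistant_pairs P r {}) \<le> card (Sigma P S)"
    using assms(1) by (intro card_mono) (auto simp: S_def)
  also have "\<dots> = (\<Sum>x\<in>P. card (S x))" using assms(1) by (simp add: S_def)
  finally have "real (card (equidistant_pairs P r {})) \<le> (\<Sum>x\<in>P. real (card (S x)))"
    by (metis of_nat_le_iff of_nat_sum)
  also have "\<dots> \<le> real (card P) * ?M" using sum_bounded_above[of P "\<lambda>x. real (card (S x))" ?M] S by simp
  finally show ?thesis .
qed


section \<open>Balancing the two bounds\<close>

text \<open>
  Here \<open>a\<close> stands for \<open>N^(1/n)\<close>, \<open>D\<close> for the number of distance vectors and \<open>E\<close> for the number of surviving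
  off-diagonal pairs. The radius is the one for which \<open>(r a)^n = a^k\<close>, that is, for which the bound for \<open>E\<close>
  is of the order of the number \<open>a^n\<close> of diagonal pairs.
\<close>

lemma balanced_radius_bound:
  fixes a r M B D E :: real
  assumes a: "a \<ge> 1" and k: "0 < k" "k < n" and M: "M > 0" and B: "B \<ge> 1" and D: "D \<ge> 0"
    and r: "r = a powr (- (real (n - k) / real n))"
    and E: "E \<le> a ^ n * (B * (r * a) ^ n / a ^ k)"
    and main: "(a ^ n)\<^sup>2 \<le> D * (M / r ^ (n - k)) * (a ^ n + E)"
  shows "a powr (real k * (2 * real n - real k) / real n) / (2 * M * B) \<le> D"
proof -
  define T where "T = a powr (real k * (2 * real n - real k) / real n)"
  have pos: "r > 0" "a > 0" "T > 0" using a by (auto simp: r T_def)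
  have rpow: "r ^ j = a powr (- (real (n - k) / real n) * real j)" for j
    using a by (simp add: r powr_powr flip: powr_realpow)
  have apow: "a ^ j = a powr real j" for j using a by (simp add: powr_realpow)
  have nk: "real (n - k) = real n - real k" using k by simp
  have T1: "a ^ n * r ^ (n - k) = T"
    unfolding rpow apow T_def powr_add[symmetric] nk using k by (simp add: field_simps)
  have T2: "T * r ^ k = a ^ k"
    unfolding rpow apow T_def powr_add[symmetric] nk using k by (simp add: field_simps)
  have X: "B * (r * a) ^ n / a ^ k = B"
  proof -
    have "(r * a) ^ n = (a ^ n * r ^ (n - k)) * r ^ k"
      using k by (simp add: power_mult_distrib mult.commute mult.left_commute flip: power_add)
    then show ?thesis using T1 T2 pos by simp
  qed
  have "(a ^ n)\<^sup>2 \<le> D * (M / r ^ (n - k)) * (a ^ n + a ^ n * B)"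
    using main E X M pos D by (elim order_trans) (intro mult_left_mono, auto)
  also have "\<dots> = a ^ n * (D * M * (1 + B) / r ^ (n - k))" by (simp add: algebra_simps)
  finally have "a ^ n * a ^ n \<le> a ^ n * (D * M * (1 + B) / r ^ (n - k))"
    unfolding power2_eq_square .
  then have "a ^ n \<le> D * M * (1 + B) / r ^ (n - k)"
    using pos by (simp only: mult_le_cancel_left_pos zero_less_power)
  then have "T \<le> D * M * (1 + B)" using pos by (simp add: T1[symmetric] pos_le_divide_eq)
  also have "\<dots> \<le> D * M * (2 * B)" using B D M by (intro mult_left_mono) auto
  finally show ?thesis
    unfolding T_def[symmetric] using M B by (simp add: divide_le_eq mult_ac)
qed

text \<open>
  Each pin keeps a fraction of at most \<open>pin_gain n c / N^(1/n)\<close> of the pairs.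
\<close>

definition pin_gain :: "nat \<Rightarrow> real \<Rightarrow> real" where
  "pin_gain n c = 2 * ((4 * real n + 5) * real n / c) ^ (n - 1)"

text \<open>
  The first factor comes from covering the fibres, the second from the number of close pairs and
  the \<open>k\<close> pins; they are \<open>M\<close> and \<open>B\<close> in \<open>balanced_radius_bound\<close>.
\<close>

definition distances_const :: "nat \<Rightarrow> nat \<Rightarrow> real \<Rightarrow> real" where
  "distances_const n k c = 2 * (2 * real n * ((4 * real n + 5) * real n) ^ (n - k))
     * (((4 * real n + 5) * 2 / c) ^ n * pin_gain n c ^ k)"

lemma pin_gain_ge_1:
  assumes "0 < c" "c \<le> 1" "n \<ge> 1"
  shows "pin_gain n c \<ge> 1"
proof -
  have "c * 1 \<le> (4 * real n + 5) * real n" using assms by (intro mult_mono) auto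
  then have "((4 * real n + 5) * real n / c) ^ (n - 1) \<ge> 1"
    using assms by (intro one_le_power) simp
  then show ?thesis unfolding pin_gain_def by linarith
qed

text \<open>
  The map \<open>f\<close> stands for any encoding of the distances to the pins. The assumption \<open>pin_gain n c \<le> a\<close>
  says that \<open>P\<close> is large enough for a hyperplane to hold at most half of its points.
\<close>

lemma exists_pins_many_distances:
  fixes P :: "'a::euclidean_space set"
  assumes n: "n = DIM('a)" and k: "0 < k" "k < n" and "finite P"
    and c: "0 < c" "c \<le> 1" and a: "a \<ge> 1" "pin_gain n c \<le> a" and N: "real (card P) = a ^ n"
    and sep: "\<And>x y. x \<in> P \<Longrightarrow> y \<in> P \<Longrightarrow> x \<noteq> y \<Longrightarrow> c / a \<le> dist x y"
    and diam: "\<And>x y. x \<in> P \<Longrightarrow> y \<in> P \<Longrightarrow> dist x y \<le> real n"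
  shows "\<exists>Q. Q \<subseteq> P \<and> card Q = k \<and> (\<forall>f :: 'a \<Rightarrow> 'b.
    (\<forall>p\<in>Q. \<forall>x\<in>P. \<forall>y\<in>P. f x = f y \<longrightarrow> dist p x = dist p y) \<longrightarrow>
    a powr (real k * (2 * real n - real k) / real n) / distances_const n k c \<le> real (card (f ` P)))"
proof -
  define h where "h = ((4 * real n + 5) * real n / (c / a)) ^ (n - 1)"
  define r where "r = a powr (- (real (n - k) / real n))"
  define M where "M = 2 * real n * ((4 * real n + 5) * real n) ^ (n - k)"
  define B where "B = ((4 * real n + 5) * 2 / c) ^ n * pin_gain n c ^ k"
  have n1: "real n \<ge> 1" using k by simp
  have ca: "0 < c / a" "c / a \<le> 1" using c a by auto
  then have can: "c / a \<le> real n" using n1 by linarith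
  have P: "P \<noteq> {}" using N a by auto
  have an: "a ^ n = a ^ (n - 1) * a" using k by (simp flip: power_Suc2)
  have h_eq: "2 * h = pin_gain n c * a ^ (n - 1)"
    by (simp add: h_def pin_gain_def flip: power_mult_distrib)
  have hN: "2 * h / real (card P) = pin_gain n c / a"
    using a unfolding h_eq N an by simp
  have "2 * h \<le> real (card P)"
    using a unfolding h_eq N an by (simp add: mult.commute mult_left_mono)
  moreover have "real (card {p\<in>P. u \<bullet> p = t}) \<le> h" if "u \<noteq> 0" for u t
    unfolding h_def n using sep diam ca(1) can that unfolding n
    by (intro card_hyperplane_section_le) auto
  ultimately obtain Q where Q: "Q \<subseteq> P" "card Q = k" "aff_dim Q = int k - 1"
    "real (card (equidistant_pairs P r Q))
      \<le> real (card (equidistant_pairs P r {})) * (pin_gain n c / a) ^ k"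
    using exists_pins[OF \<open>finite P\<close> P, of h k r] k n unfolding hN by auto
  have "r \<le> a powr 0" unfolding r_def using a k by (intro powr_mono) auto
  then have r1: "r \<le> 1" "r > 0" using a by (auto simp: r_def)
  have "1 / a = a powr (- 1)" using a by (simp add: powr_minus_divide)
  also have "\<dots> \<le> r" unfolding r_def using a k by (intro powr_mono) (auto simp: field_simps)
  finally have "1 / a \<le> r" .
  moreover have "c / a \<le> 1 / a" using c a by (intro divide_right_mono) auto
  ultimately have "c / a \<le> 2 * r" using r1 by linarith
  then have "real (card (equidistant_pairs P r {}))
      \<le> real (card P) * ((4 * real n + 5) * (2 * r) / (c / a)) ^ n"
    unfolding n using \<open>finite P\<close> sep ca by (intro card_close_pairs_le) auto
  moreover have "(pin_gain n c / a) ^ k \<ge> 0" using pin_gain_ge_1[of c n] c k a by simp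
  ultimately have "real (card (equidistant_pairs P r {})) * (pin_gain n c / a) ^ k
      \<le> real (card P) * ((4 * real n + 5) * (2 * r) / (c / a)) ^ n * (pin_gain n c / a) ^ k"
    by (rule mult_right_mono)
  with Q(4) have "real (card (equidistant_pairs P r Q))
      \<le> real (card P) * ((4 * real n + 5) * (2 * r) / (c / a)) ^ n * (pin_gain n c / a) ^ k"
    by (rule order_trans)
  also have "(4 * real n + 5) * (2 * r) / (c / a) = (4 * real n + 5) * 2 / c * (r * a)" by simp
  also have "real (card P) * \<dots> ^ n * (pin_gain n c / a) ^ k = a ^ n * (B * (r * a) ^ n / a ^ k)"
    unfolding N B_def power_mult_distrib[of _ "r * a"] power_divide[of "pin_gain n c"] by simp
  finally have E: "real (card (equidistant_pairs P r Q)) \<le> a ^ n * (B * (r * a) ^ n / a ^ k)" .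
  have M: "M > 0" unfolding M_def using n1 by simp
  have B: "B \<ge> 1"
  proof -
    have "1 \<le> (4 * real n + 5) * 2 / c" using c n1 by simp
    then have "1 * 1 \<le> B" unfolding B_def
      using pin_gain_ge_1[of c n] c k by (intro mult_mono one_le_power) auto
    then show ?thesis by simp
  qed
  have "a powr (real k * (2 * real n - real k) / real n) / distances_const n k c \<le> real (card (f ` P))"
    if f: "\<forall>p\<in>Q. \<forall>x\<in>P. \<forall>y\<in>P. f x = f y \<longrightarrow> dist p x = dist p y" for f :: "'a \<Rightarrow> 'b"
  proof -
    have "finite Q" "Q \<noteq> {}" "aff_dim Q = int (card Q) - 1" "card Q \<le> DIM('a)"
      using Q(1-3) \<open>finite P\<close> k n finite_subset by auto
    moreover have "dist p x = dist p y" if "p \<in> Q" "x \<in> P" "y \<in> P" "f x = f y" for p x y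
      using f that by blast
    moreover have "r \<le> real n" using r1 n1 by linarith
    ultimately have "real (card P) ^ 2 \<le> real (card (f ` P))
      * (2 * real n * ((4 * real n + 5) * real n / r) ^ (n - card Q))
      * (real (card P) + real (card (equidistant_pairs P r Q)))"
      using \<open>finite P\<close> diam r1(2) unfolding n by (intro card_square_le_equidistant_pairs)
    also have "2 * real n * ((4 * real n + 5) * real n / r) ^ (n - card Q) = M / r ^ (n - k)"
      by (simp add: M_def Q(2) power_divide)
    finally have "(a ^ n)\<^sup>2 \<le> real (card (f ` P)) * (M / r ^ (n - k))
      * (a ^ n + real (card (equidistant_pairs P r Q)))" unfolding N .
    from balanced_radius_bound[OF a(1) k M B _ r_def E this]
    show ?thesis by (simp add: distances_const_def M_def B_def mult.assoc)
  qed
  with Q(1,2) show ?thesis by blast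
qed

lemma exponent_le:
  fixes n k :: nat
  assumes "1 \<le> k" "k < n"
  shows "real k / alpha_plus n k \<le> real k * (2 * real n - real k) / real n ^ 2"
proof -
  define x y where "x = real n" and "y = real k"
  have xy: "1 \<le> y" "y < x" using assms by (auto simp: x_def y_def)
  have "0 \<le> (x - y) * ((y - 1) * x + y)" using xy by (intro mult_nonneg_nonneg add_nonneg_nonneg) auto
  then have "x\<^sup>2 * (2 * x + 1) \<le> (2 * x - y) * (x\<^sup>2 + x * y + y)"
    by (simp add: algebra_simps power2_eq_square)
  moreover have "x\<^sup>2 + x * y + y > 0" using xy by (intro add_pos_pos) auto
  ultimately have "(2 * x + 1) / (x\<^sup>2 + x * y + y) \<le> (2 * x - y) / x\<^sup>2"
    using xy by (simp add: divide_le_eq le_divide_eq mult.commute)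
  then have "y * ((2 * x + 1) / (x\<^sup>2 + x * y + y)) \<le> y * ((2 * x - y) / x\<^sup>2)"
    using xy by (intro mult_left_mono) auto
  then show ?thesis by (simp add: alpha_plus_def x_def y_def)
qed

lemma dist_unit_cube_le:
  fixes x y :: "real ^ 'n"
  assumes "x \<in> cbox 0 1" "y \<in> cbox 0 1"
  shows "dist x y \<le> real CARD('n)"
proof -
  have "dist x y \<le> (\<Sum>i\<in>UNIV. \<bar>(x - y) $ i\<bar>)" unfolding dist_norm by (rule norm_le_l1_cart)
  also have "\<dots> \<le> (\<Sum>i\<in>(UNIV::'n set). 1)"
    using assms by (intro sum_mono) (auto simp: mem_box_cart abs_le_iff, smt+)
  finally show ?thesis by simp
qed

theorem corollaryB1:
  fixes c \<epsilon> :: real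
  assumes "2 \<le> CARD('n::finite)" and "CARD('k::finite) < CARD('n)"
    and "c > 0" and "\<epsilon> > 0"
  shows "\<exists>C > 0. \<forall>(N::nat) (P :: (real ^ 'n) set).
           N \<ge> 1 \<and> finite P \<and> card P = N \<and> P \<subseteq> cbox 0 1 \<and>
           (\<forall>p\<in>P. \<forall>q\<in>P. p \<noteq> q \<longrightarrow> norm (p - q) \<ge> c * real N powr (- 1 / real CARD('n))) \<longrightarrow>
           (\<exists>x :: (real ^ 'n) ^ 'k. (\<forall>j. x $ j \<in> P) \<and>
              real (card (star_distance_set x P))
                \<ge> C * real N powr (real CARD('k) / alpha_plus CARD('n) CARD('k) - \<epsilon>))"
proof -
  define n k where "n = CARD('n)" and "k = CARD('k)"
  \<comment> \<open>With \<open>c' \<le> 1\<close> the separation stays below the radius \<open>r\<close>.\<close>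
  define c' where "c' = min c 1"
  define e where "e = real k * (2 * real n - real k) / real n"
  have k: "0 < k" "k < n" using assms(2) by (auto simp: n_def k_def)
  have c': "0 < c'" "c' \<le> 1" using assms(3) by (auto simp: c'_def)
  have gain: "pin_gain n c' \<ge> 1" using pin_gain_ge_1 c' k by simp
  have const: "distances_const n k c' > 0"
    unfolding distances_const_def using gain c' k by (intro mult_pos_pos zero_less_power) auto
  have e0: "e \<ge> 0" using k by (simp add: e_def)
  define C where "C = min (1 / distances_const n k c') (1 / pin_gain n c' powr e)"
  have "C > 0" using const gain by (simp add: C_def)
  moreover have "\<exists>x :: (real ^ 'n) ^ 'k. (\<forall>j. x $ j \<in> P) \<and>
      C * real N powr (real k / alpha_plus n k - \<epsilon>) \<le> real (card (star_distance_set x P))"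
    if N: "N \<ge> 1" and P: "finite P" "card P = N" "P \<subseteq> cbox 0 1"
      and sep: "\<forall>p\<in>P. \<forall>q\<in>P. p \<noteq> q \<longrightarrow> norm (p - q) \<ge> c * real N powr (- 1 / real n)"
    for N and P :: "(real ^ 'n) set"
  proof -
    define a where "a = real N powr (1 / real n)"
    have a1: "a \<ge> 1" using N by (simp add: a_def ge_one_powr_ge_zero)
    have aN: "real N = a ^ n"
      using N k by (simp add: a_def powr_powr flip: powr_realpow)
    have "real N powr (real k / alpha_plus n k - \<epsilon>)
        \<le> real N powr (real k * (2 * real n - real k) / real n ^ 2)"
      using exponent_le[of k n] k assms(4) N by (intro powr_mono) auto
    also have "\<dots> = a powr e"
      by (simp add: a_def e_def powr_powr power2_eq_square)
    finally have powr: "C * real N powr (real k / alpha_plus n k - \<epsilon>) \<le> C * a powr e"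
      using \<open>C > 0\<close> by simp
    define F where "F x p = (\<chi> j. norm (x $ j - p))" for x :: "(real ^ 'n) ^ 'k" and p
    have F: "star_distance_set x P = F x ` P" for x
      by (auto simp: star_distance_set_def F_def)
    show ?thesis
    proof (cases "pin_gain n c' \<le> a")
      case True
      have sep': "c' / a \<le> dist x y" if "x \<in> P" "y \<in> P" "x \<noteq> y" for x y
      proof -
        have "c' / a \<le> c / a" using a1 by (simp add: c'_def divide_right_mono)
        also have "\<dots> = c * real N powr (- 1 / real n)"
          by (simp add: a_def powr_minus_divide)
        also have "\<dots> \<le> dist x y" using sep that by (simp add: dist_norm)
        finally show ?thesis .
      qed
      have diam: "dist x y \<le> real n" if "x \<in> P" "y \<in> P" for x y
        using dist_unit_cube_le[of x y] P(3) that by (auto simp: n_def)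
      have "n = DIM(real ^ 'n)" by (simp add: n_def)
      from exists_pins_many_distances[OF this k P(1) c' a1 True _ sep' diam, where 'b = "real ^ 'k"]
      obtain Q where Q: "Q \<subseteq> P" "card Q = k" "\<forall>f :: real ^ 'n \<Rightarrow> real ^ 'k.
          (\<forall>p\<in>Q. \<forall>x\<in>P. \<forall>y\<in>P. f x = f y \<longrightarrow> dist p x = dist p y) \<longrightarrow>
          a powr e / distances_const n k c' \<le> real (card (f ` P))"
        using P(2) aN unfolding e_def by auto
      have "finite Q" using Q(1) P(1) finite_subset by blast
      then obtain \<beta> where \<beta>: "bij_betw \<beta> (UNIV :: 'k set) Q"
        using Q(2) finite_same_card_bij[of "UNIV :: 'k set" Q] by (auto simp: k_def)
      define x where "x = (\<chi> j. \<beta> j)"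
      have "dist p y = dist p z" if pin: "p \<in> Q" and eq: "F x y = F x z" for p y z
      proof -
        obtain j where "p = \<beta> j" using \<beta> pin unfolding bij_betw_def by blast
        then show ?thesis
          using arg_cong[OF eq, of "\<lambda>v. v $ j"] by (simp add: F_def x_def dist_norm)
      qed
      then have "a powr e / distances_const n k c' \<le> real (card (F x ` P))"
        using Q(3)[rule_format, of "F x"] by blast
      moreover have "C * a powr e \<le> 1 / distances_const n k c' * a powr e"
        by (intro mult_right_mono) (auto simp: C_def)
      moreover have "x $ j \<in> P" for j using \<beta> Q(1) by (auto simp: x_def bij_betw_def)
      ultimately show ?thesis using powr F[of x] by (intro exI[of _ x]) auto
    next
      case False
      \<comment> \<open>\<open>P\<close> has bounded size and possibly fewer than \<open>k\<close> points: the trivial bound 1, with equal pins,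
        is enough after adjusting the constant.\<close>
      obtain p where p: "p \<in> P" using N P by (metis card.empty ex_in_conv not_one_le_zero)
      define x :: "(real ^ 'n) ^ 'k" where "x = (\<chi> j. p)"
      have "a powr e \<le> pin_gain n c' powr e" using False a1 e0 by (intro powr_mono2) auto
      then have "C * a powr e \<le> 1 / pin_gain n c' powr e * pin_gain n c' powr e"
        using gain by (intro mult_mono) (auto simp: C_def)
      also have "\<dots> = 1" using gain by simp
      also have "1 \<le> real (card (F x ` P))"
        using p P(1) by (simp add: Suc_le_eq card_gt_0_iff) blast
      finally show ?thesis
        using powr p F[of x] by (intro exI[of _ x]) (auto simp: x_def)
    qed
  qed
  ultimately show ?thesis unfolding n_def k_def by blast
qed

end
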